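(* Let $K$ be a radically closed field of characteristic $0$ and let $G=\mathrm{Aff}(K)\times\mathrm{Aff}(K)$ act on $K[X]$ by $(\alpha,\beta)\cdot P=\alpha\circ P\circ\beta^{-1}$. The isotropy groups $G_P=\{g\in G: g\cdot P=P\}$ are, up to isomorphism: - for $P=1$: $G_P\cong K^{*}\times\mathrm{Aff}(K)$; - for $P=X$: $G_P\cong\mathrm{Aff}(K)$; - for $P=X^d$ with $d\ge 2$: $G_P\cong K^{*}$; - for $P=X^d+dX^e+\dots+a_{e_i}X^{e_i}+\dots$, a $\delta$-polynomial which is not a monomial, where the $e_i$ are the exponents smaller than $e$ occurring in $P$ with nonzero coefficient: $G_P\cong\mathbb{Z}_n$, where $n=\gcd(\Delta,\dots,d-e_i,\dots)$ and $\Delta=d-e$.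
   Context: $K$ is radically closed: every polynomial $X^n-a$ ($a\in K$, $n\ge 2$) splits over $K$. $\mathrm{Aff}(K)=\{aX+b\in K[X]: a\ne 0\}$ is a group under composition; $K^*=K\setminus\{0\}$ under multiplication; $\mathbb{Z}_n$ is the cyclic group of order $n$. A polynomial $P$ of degree $d$ is a $\delta$-polynomial if $P(X)=X^d$ (with $X^0=1$), or $P(X)=X^d+dX^e+a_{e-1}X^{e-1}+\dots+a_1X$ with $1\le e\le d-2$. Every $G$-orbit contains a $\delta$-polynomial, so the list describes all isotropy groups up to isomorphism. *)

theory Defs
  imports
    "HOL-Computational_Algebra.Polynomial"
    "HOL-Algebra.Group_Action"
    "HOL-Algebra.Elementary_Groups"
begin

definition splits :: "'a::field poly \<Rightarrow> bool" where
  "splits p \<longleftrightarrow> (\<exists>c rs. c \<noteq> 0 \<and> p = smult c (\<Prod>r\<leftarrow>rs. [:- r, 1:]))"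

definition radically_closed :: "'a::field itself \<Rightarrow> bool" where
  "radically_closed (_ :: 'a itself) \<longleftrightarrow>
     (\<forall>n\<ge>2. \<forall>a::'a. splits (monom 1 n - [:a:]))"

definition mult_group :: "'a::field monoid" where
  "mult_group = \<lparr>carrier = {x. x \<noteq> 0}, mult = (*), one = 1\<rparr>"

definition aff_group :: "'a::field poly monoid" where
  "aff_group = \<lparr>carrier = {[:b, a:] | a b. a \<noteq> 0}, mult = pcompose, one = [:0, 1:]\<rparr>"

definition aff_act :: "'a::field poly \<times> 'a poly \<Rightarrow> 'a poly \<Rightarrow> 'a poly" where
  "aff_act = (\<lambda>(\<alpha>, \<beta>) P. \<alpha> \<circ>\<^sub>p P \<circ>\<^sub>p inv\<^bsub>aff_group\<^esub> \<beta>)"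

definition isotropy_group :: "'a::field poly \<Rightarrow> ('a poly \<times> 'a poly) monoid" where
  "isotropy_group P =
     (aff_group \<times>\<times> aff_group)
       \<lparr>carrier := stabilizer (aff_group \<times>\<times> aff_group) aff_act P\<rparr>"

text \<open>The polynomial \<open>X^d + d X^e + a_(e-1) X^(e-1) + ... + a_1 X\<close>; the values of \<open>a\<close> outside
  \<open>{1..<e}\<close> are irrelevant.\<close>

definition delta_form :: "nat \<Rightarrow> nat \<Rightarrow> (nat \<Rightarrow> 'a::field) \<Rightarrow> 'a poly" where
  "delta_form d e a = monom 1 d + monom (of_nat d) e + (\<Sum>i\<in>{1..<e}. monom (a i) i)"

definition delta_polynomial :: "'a::field poly \<Rightarrow> bool" where
  "delta_polynomial P \<longleftrightarrow>
     (\<exists>d. P = monom 1 d) \<or>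
     (\<exists>d e a. 1 \<le> e \<and> e + 2 \<le> d \<and> P = delta_form d e a)"

lemma group_mult_group: "group (mult_group :: 'a::field monoid)"
  by (rule groupI) (auto simp: mult_group_def mult.assoc intro: exI[of _ "inverse _"])

lemma aff_pcompose: "[:b, a:] \<circ>\<^sub>p [:d, c:] = [:b + a * d, a * c :: 'a::field:]"
  by (simp add: pcompose_pCons algebra_simps)

lemma group_aff_group: "group (aff_group :: 'a::field poly monoid)"
proof (rule groupI)
  fix p :: "'a poly" assume "p \<in> carrier aff_group"
  then obtain a b where p: "p = [:b, a:]" "a \<noteq> 0"
    by (auto simp: aff_group_def)
  have "[:- b / a, 1 / a:] \<circ>\<^sub>p p = [:0, 1:]"
    using p by (simp add: aff_pcompose)
  moreover have "[:- b / a, 1 / a:] \<in> carrier aff_group"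
    using p by (auto simp: aff_group_def)
  ultimately show "\<exists>q\<in>carrier aff_group. q \<otimes>\<^bsub>aff_group\<^esub> p = \<one>\<^bsub>aff_group\<^esub>"
    by (intro bexI[of _ "[:- b / a, 1 / a:]"]) (simp_all add: aff_group_def)
qed (auto simp: aff_group_def aff_pcompose pcompose_assoc simp del: pcompose_pCons)

lemma group_action_aff_act:
  "group_action (aff_group \<times>\<times> aff_group) (UNIV :: 'a::field poly set) aff_act"
proof -
  interpret A: group "aff_group :: 'a poly monoid" by (rule group_aff_group)
  interpret AA: group "(aff_group :: 'a poly monoid) \<times>\<times> aff_group"
    by (intro DirProd_group group_aff_group)
  have one: "aff_act \<one>\<^bsub>aff_group \<times>\<times> aff_group\<^esub> P = P" for P :: "'a poly"
    using A.inv_one by (simp add: aff_act_def) (simp add: aff_group_def pcompose_pCons)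
  have mult: "aff_act (g \<otimes>\<^bsub>aff_group \<times>\<times> aff_group\<^esub> h) P = aff_act g (aff_act h P)"
    if "g \<in> carrier (aff_group \<times>\<times> aff_group)" "h \<in> carrier (aff_group \<times>\<times> aff_group)"
    for g h and P :: "'a poly"
  proof -
    obtain g1 g2 h1 h2 where gh: "g = (g1, g2)" "h = (h1, h2)"
      "g2 \<in> carrier aff_group" "h2 \<in> carrier aff_group"
      using \<open>g \<in> _\<close> \<open>h \<in> _\<close> by (cases g; cases h; auto)
    have m: "x \<otimes>\<^bsub>aff_group\<^esub> y = x \<circ>\<^sub>p y" for x y :: "'a poly"
      by (simp add: aff_group_def)
    show ?thesis
      using A.inv_mult_group[OF gh(3,4)] by (simp add: gh(1,2) aff_act_def m pcompose_assoc)
  qed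
  have bij: "aff_act g \<in> Bij UNIV" if g: "g \<in> carrier (aff_group \<times>\<times> aff_group)"
    for g :: "'a poly \<times> 'a poly"
  proof -
    let ?h = "inv\<^bsub>aff_group \<times>\<times> aff_group\<^esub> g"
    have "aff_act g (aff_act ?h P) = P" "aff_act ?h (aff_act g P) = P" for P
      using mult[OF g AA.inv_closed[OF g]] mult[OF AA.inv_closed[OF g] g] g
      by (simp_all only: one AA.r_inv AA.l_inv flip: mult[OF g AA.inv_closed[OF g]] mult[OF AA.inv_closed[OF g] g])
    then have "bij (aff_act g)"
      by (intro bijI') metis+
    then show ?thesis by (simp add: Bij_def)
  qed
  show ?thesis
    unfolding group_action_def group_hom_def group_hom_axioms_def
  proof (intro conjI AA.is_group group_BijGroup homI)
    fix g h :: "'a poly \<times> 'a poly"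
    assume g: "g \<in> carrier (aff_group \<times>\<times> aff_group)" and h: "h \<in> carrier (aff_group \<times>\<times> aff_group)"
    show "aff_act g \<in> carrier (BijGroup UNIV)"
      using bij[OF g] by (simp add: BijGroup_def)
    show "aff_act (g \<otimes>\<^bsub>aff_group \<times>\<times> aff_group\<^esub> h) =
        aff_act g \<otimes>\<^bsub>BijGroup UNIV\<^esub> aff_act h"
      using bij[OF g] bij[OF h] mult[OF g h] by (simp add: BijGroup_def compose_def fun_eq_iff)
  qed
qed

end

theory Submission
  imports Defs
begin

text \<open>
  A pair \<open>(\<alpha>, \<beta>)\<close> fixes \<open>P\<close> exactly when \<open>\<alpha> \<circ>\<^sub>p P = P \<circ>\<^sub>p \<beta>\<close>
  (\<open>mem_isotropy_group_iff\<close>), so everything comes down to solving this equation for affine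
  \<open>\<alpha> = aX + b\<close> and \<open>\<beta> = cX + t\<close>.

  For \<open>P = 1\<close> it says that \<open>\<alpha>\<close> fixes the point 1, and such \<open>\<alpha>\<close> are determined by their slope, while
  \<open>\<beta>\<close> is free; for \<open>P = X\<close> it says \<open>\<alpha> = \<beta>\<close>. Now let \<open>P\<close> have degree \<open>d \<ge> 2\<close>, with vanishing
  constant term and vanishing coefficient of \<open>X^(d-1)\<close>. The coefficient of \<open>X^(d-1)\<close> in
  \<open>P(cX + t)\<close> is a nonzero multiple of \<open>t\<close>, whereas that of \<open>\<alpha> \<circ>\<^sub>p P\<close> is zero; hence \<open>t = 0\<close>, then
  \<open>b = 0\<close>, and comparing coefficients leaves \<open>a = c^d\<close> together with \<open>c^(d-i) = 1\<close> for every
  exponent \<open>i\<close> occurring in \<open>P\<close> (\<open>mem_isotropy_group_reduced_iff\<close>). If \<open>P = X^d\<close>, then \<open>c\<close> is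
  arbitrary in \<open>K*\<close>, which parametrizes the isotropy group. Otherwise the conditions amount to \<open>c^n = 1\<close> for the
  greatest common divisor \<open>n\<close> of the numbers \<open>d - i\<close>, so the isotropy group is isomorphic to the group of
  \<open>n\<close>-th roots of unity.

  That this group is cyclic of order exactly \<open>n\<close> is where radical closedness and characteristic 0
  meet: a primitive \<open>n\<close>-th root of unity is built up one prime factor of \<open>n\<close> at a time
  (\<open>radically_closed_primitive_root_of_unity\<close>).

  Finally, points of one orbit have isomorphic stabilizers, and every orbit contains a
  \<open>\<delta>\<close>-polynomial: translating the argument removes the coefficient of \<open>X^(d-1)\<close>, an affine map on
  the left removes the constant term and makes the polynomial monic, and rescaling \<open>X\<close> by a
  suitable radical turns the next nonzero coefficient, if there is one, into \<open>d\<close>.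
\<close>

section \<open>Stabilizers along an orbit\<close>

text \<open>Conjugation by \<open>g\<close> carries the stabilizer of \<open>x\<close> onto that of \<open>\<phi> g x\<close>.\<close>

lemma (in group_action) stabilizer_iso_along_orbit:
  assumes x: "x \<in> E" and g: "g \<in> carrier G"
  shows "G\<lparr>carrier := stabilizer G \<phi> x\<rparr> \<cong> G\<lparr>carrier := stabilizer G \<phi> (\<phi> g x)\<rparr>"
proof -
  interpret group G
    using group_hom group_hom.axioms(1) by auto
  let ?conj = "\<lambda>h. g \<otimes> h \<otimes> inv g"
  have y: "\<phi> g x \<in> E"
    using element_image g x by blast
  have pull: "\<phi> (inv g) (\<phi> g x) = x"
    using orbit_sym_aux g x by blast
  have maps: "?conj h \<in> stabilizer G \<phi> (\<phi> g x)" if "h \<in> stabilizer G \<phi> x" for h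
    using that g x y pull by (auto simp: stabilizer_def composition_rule)
  have surj: "k \<in> ?conj ` stabilizer G \<phi> x" if k: "k \<in> stabilizer G \<phi> (\<phi> g x)" for k
  proof (rule image_eqI)
    show "inv g \<otimes> k \<otimes> g \<in> stabilizer G \<phi> x"
      using k g x y pull by (auto simp: stabilizer_def composition_rule)
    show "k = g \<otimes> (inv g \<otimes> k \<otimes> g) \<otimes> inv g"
      using k g conjugation_is_surj by (simp add: stabilizer_def)
  qed
  have "inj_on ?conj (carrier G)"
    using conjugation_is_inj[OF g] by (auto intro: inj_onI)
  then have "inj_on ?conj (stabilizer G \<phi> x)"
    by (rule inj_on_subset) (auto simp: stabilizer_def)
  then have "bij_betw ?conj (stabilizer G \<phi> x) (stabilizer G \<phi> (\<phi> g x))"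
    using maps surj by (auto simp: bij_betw_def)
  moreover have "?conj (h \<otimes> k) = ?conj h \<otimes> ?conj k"
    if "h \<in> stabilizer G \<phi> x" "k \<in> stabilizer G \<phi> x" for h k
  proof -
    have "h \<in> carrier G" "k \<in> carrier G"
      using that by (auto simp: stabilizer_def)
    then show ?thesis
      using g by (simp add: m_assoc inv_solve_left)
  qed
  ultimately have "?conj \<in> iso (G\<lparr>carrier := stabilizer G \<phi> x\<rparr>)
      (G\<lparr>carrier := stabilizer G \<phi> (\<phi> g x)\<rparr>)"
    by (auto simp: iso_def hom_def bij_betw_def)
  then show ?thesis
    by (auto simp: is_iso_def)
qed

lemma aff_carrier_iff: "p \<in> carrier aff_group \<longleftrightarrow> (\<exists>a b. a \<noteq> 0 \<and> p = [:b, a:])"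
  by (auto simp: aff_group_def)

lemma aff_inv_pcompose:
  assumes "p \<in> carrier aff_group"
  shows "p \<circ>\<^sub>p inv\<^bsub>aff_group\<^esub> p = [:0, 1:]" "inv\<^bsub>aff_group\<^esub> p \<circ>\<^sub>p p = [:0, 1:]"
  using group.r_inv[OF group_aff_group assms] group.l_inv[OF group_aff_group assms]
  by (simp_all add: aff_group_def)

lemma mem_isotropy_group_iff:
  "(\<alpha>, \<beta>) \<in> carrier (isotropy_group P) \<longleftrightarrow>
     \<alpha> \<in> carrier aff_group \<and> \<beta> \<in> carrier aff_group \<and> \<alpha> \<circ>\<^sub>p P = P \<circ>\<^sub>p \<beta>"
proof -
  have "\<alpha> \<circ>\<^sub>p P \<circ>\<^sub>p inv\<^bsub>aff_group\<^esub> \<beta> = P \<longleftrightarrow> \<alpha> \<circ>\<^sub>p P = P \<circ>\<^sub>p \<beta>"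
    if \<beta>: "\<beta> \<in> carrier aff_group"
  proof
    assume "\<alpha> \<circ>\<^sub>p P \<circ>\<^sub>p inv\<^bsub>aff_group\<^esub> \<beta> = P"
    then have "P \<circ>\<^sub>p \<beta> = (\<alpha> \<circ>\<^sub>p P) \<circ>\<^sub>p (inv\<^bsub>aff_group\<^esub> \<beta> \<circ>\<^sub>p \<beta>)"
      by (metis pcompose_assoc)
    then show "\<alpha> \<circ>\<^sub>p P = P \<circ>\<^sub>p \<beta>"
      by (simp only: aff_inv_pcompose[OF \<beta>] pcompose_idR)
  next
    assume "\<alpha> \<circ>\<^sub>p P = P \<circ>\<^sub>p \<beta>"
    then have "\<alpha> \<circ>\<^sub>p P \<circ>\<^sub>p inv\<^bsub>aff_group\<^esub> \<beta> = P \<circ>\<^sub>p (\<beta> \<circ>\<^sub>p inv\<^bsub>aff_group\<^esub> \<beta>)"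
      by (metis pcompose_assoc)
    then show "\<alpha> \<circ>\<^sub>p P \<circ>\<^sub>p inv\<^bsub>aff_group\<^esub> \<beta> = P"
      by (simp only: aff_inv_pcompose[OF \<beta>] pcompose_idR)
  qed
  then show ?thesis
    by (auto simp: isotropy_group_def stabilizer_def aff_act_def)
qed

text \<open>The action composes with the inverse of its second component on the right; feeding it
  \<open>inv \<beta>\<close> therefore lets \<open>\<beta>\<close> be composed directly.\<close>

lemma isotropy_group_iso_along_orbit:
  assumes \<alpha>: "\<alpha> \<in> carrier aff_group" and \<beta>: "\<beta> \<in> carrier aff_group"
  shows "isotropy_group Q \<cong> isotropy_group (\<alpha> \<circ>\<^sub>p Q \<circ>\<^sub>p \<beta>)"
proof -
  have "inv\<^bsub>aff_group\<^esub> \<beta> \<in> carrier aff_group"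
    by (intro group.inv_closed group_aff_group \<beta>)
  then have "(\<alpha>, inv\<^bsub>aff_group\<^esub> \<beta>) \<in> carrier (aff_group \<times>\<times> aff_group)"
    using \<alpha> by simp
  from group_action.stabilizer_iso_along_orbit[OF group_action_aff_act UNIV_I this, of Q]
  have "isotropy_group Q \<cong> isotropy_group (aff_act (\<alpha>, inv\<^bsub>aff_group\<^esub> \<beta>) Q)"
    unfolding isotropy_group_def .
  then show ?thesis
    by (simp add: aff_act_def group.inv_inv[OF group_aff_group \<beta>])
qed

text \<open>The isotropy groups below are all given by explicit parametrizations by known groups, so the
  isomorphism is constructed from the known group and then inverted.\<close>

lemma isotropy_group_isoI:
  assumes "group H"
    and "bij_betw f (carrier H) (carrier (isotropy_group P))"
    and "\<And>x y. x \<in> carrier H \<Longrightarrow> y \<in> carrier H \<Longrightarrow>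
      f (x \<otimes>\<^bsub>H\<^esub> y) = (fst (f x) \<circ>\<^sub>p fst (f y), snd (f x) \<circ>\<^sub>p snd (f y))"
  shows "isotropy_group P \<cong> H"
proof -
  have "f \<in> hom H (isotropy_group P)"
    using assms(2,3)
    by (auto simp: hom_def bij_betw_def isotropy_group_def aff_group_def mult_DirProd')
  then have "H \<cong> isotropy_group P"
    using assms(2) by (auto simp: is_iso_def iso_def)
  then show ?thesis
    by (rule group.iso_sym[OF assms(1)])
qed

section \<open>Constants and the identity\<close>

lemma isotropy_group_one:
  "isotropy_group (1 :: 'a::field poly) \<cong> (mult_group :: 'a monoid) \<times>\<times> (aff_group :: 'a poly monoid)"
proof (rule isotropy_group_isoI)
  let ?f = "\<lambda>(a :: 'a, \<beta> :: 'a poly). ([:1 - a, a:], \<beta>)"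
  show "group ((mult_group :: 'a monoid) \<times>\<times> (aff_group :: 'a poly monoid))"
    by (intro DirProd_group group_mult_group group_aff_group)
  have mem: "(\<alpha>, \<beta>) \<in> carrier (isotropy_group 1) \<longleftrightarrow>
      \<beta> \<in> carrier aff_group \<and> (\<exists>a. a \<noteq> 0 \<and> \<alpha> = [:1 - a, a:])" for \<alpha> \<beta> :: "'a poly"
    by (auto simp: mem_isotropy_group_iff pcompose_1 aff_carrier_iff[of \<alpha>] pcompose_pCons
        one_pCons algebra_simps)
  show "bij_betw ?f (carrier (mult_group \<times>\<times> aff_group)) (carrier (isotropy_group 1))"
    by (auto simp: bij_betw_def inj_on_def mem mult_group_def image_iff)
  show "?f (x \<otimes>\<^bsub>mult_group \<times>\<times> aff_group\<^esub> y) = (fst (?f x) \<circ>\<^sub>p fst (?f y), snd (?f x) \<circ>\<^sub>p snd (?f y))"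
    for x y
    by (auto simp: mult_DirProd' mult_group_def aff_group_def aff_pcompose algebra_simps
        split: prod.splits simp del: pcompose_pCons)
qed

lemma isotropy_group_X: "isotropy_group [:0, 1 :: 'a::field:] \<cong> (aff_group :: 'a poly monoid)"
proof (rule isotropy_group_isoI[OF group_aff_group])
  have id: "[:0, 1:] \<circ>\<^sub>p \<beta> = \<beta>" for \<beta> :: "'a poly"
    by (simp add: pcompose_pCons)
  show "bij_betw (\<lambda>\<beta>. (\<beta>, \<beta>)) (carrier aff_group) (carrier (isotropy_group [:0, 1 :: 'a:]))"
    by (auto simp: bij_betw_def inj_on_def mem_isotropy_group_iff id)
qed (simp add: aff_group_def)

section \<open>Reduced polynomials of degree at least two\<close>

lemma coeff_pcompose_affine_top:
  fixes p :: "'a::comm_ring_1 poly"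
  assumes "degree p \<le> n"
  shows "coeff (p \<circ>\<^sub>p [:t, c:]) n = c ^ n * coeff p n"
  using assms
proof (induction p arbitrary: n)
  case 0
  then show ?case by simp
next
  case (pCons a p)
  show ?case
  proof (cases n)
    case 0
    with pCons have "p = 0"
      by (simp split: if_splits)
    with 0 show ?thesis by simp
  next
    case (Suc m)
    with pCons.prems have deg: "degree p \<le> m"
      by (simp split: if_splits)
    have "degree (p \<circ>\<^sub>p [:t, c:]) \<le> degree p * degree [:t, c:]"
      by (rule degree_pcompose_le)
    also have "\<dots> \<le> m * 1"
      by (intro mult_mono deg) auto
    finally have "coeff (p \<circ>\<^sub>p [:t, c:]) n = 0"
      using Suc by (intro coeff_eq_0) simp
    then show ?thesis
      using pCons.IH[OF deg] Suc by (simp add: pcompose_pCons coeff_pCons split: nat.splits)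
  qed
qed

text \<open>Only the two leading terms of \<open>p\<close> contribute to the coefficient of \<open>X^n\<close>. This is what detects
  a translation: for \<open>p\<close> of degree \<open>n + 1\<close> in characteristic 0, the coefficient is an injective
  affine function of \<open>t\<close> as long as \<open>c \<noteq> 0\<close>.\<close>

lemma coeff_pcompose_affine_subtop:
  fixes p :: "'a::comm_ring_1 poly"
  assumes "degree p \<le> Suc n"
  shows "coeff (p \<circ>\<^sub>p [:t, c:]) n = c ^ n * (coeff p n + of_nat (Suc n) * t * coeff p (Suc n))"
  using assms
proof (induction p arbitrary: n)
  case 0
  then show ?case by simp
next
  case (pCons a p)
  have deg: "degree p \<le> n"
    using pCons.prems by (simp split: if_splits)
  have top: "coeff (p \<circ>\<^sub>p [:t, c:]) n = c ^ n * coeff p n"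
    by (rule coeff_pcompose_affine_top[OF deg])
  show ?case
  proof (cases n)
    case 0
    then show ?thesis
      using top by (simp add: pcompose_pCons)
  next
    case (Suc m)
    have "coeff (p \<circ>\<^sub>p [:t, c:]) m = c ^ m * (coeff p m + of_nat (Suc m) * t * coeff p (Suc m))"
      using pCons.IH deg Suc by simp
    then show ?thesis
      using top Suc by (simp add: pcompose_pCons algebra_simps)
  qed
qed

text \<open>The vanishing coefficient of \<open>X^(d-1)\<close> forbids translations in \<open>\<beta>\<close>, and then the vanishing
  constant term forbids them in \<open>\<alpha>\<close>. What remains is \<open>a P(X) = P(cX)\<close>, an equation between
  individual coefficients, whose leading one gives \<open>a = c^d\<close>.\<close>

lemma mem_isotropy_group_reduced_iff:
  fixes P :: "'a::field_char_0 poly"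
  assumes d: "degree P = d" "d \<ge> 2"
    and sub: "coeff P (d - 1) = 0" and const: "coeff P 0 = 0"
  shows "g \<in> carrier (isotropy_group P) \<longleftrightarrow>
    (\<exists>c. c \<noteq> 0 \<and> g = ([:0, c ^ d:], [:0, c:]) \<and> (\<forall>i. coeff P i \<noteq> 0 \<longrightarrow> c ^ (d - i) = 1))"
proof -
  have lc: "coeff P d \<noteq> 0"
    using d by auto
  have scale: "[:b, a:] \<circ>\<^sub>p P = [:b:] + smult a P" for a b
    by (simp add: pcompose_pCons)
  have deg: "i \<le> d" if "coeff P i \<noteq> 0" for i
    using that d le_degree by blast
  show ?thesis
  proof
    assume g: "g \<in> carrier (isotropy_group P)"
    obtain \<alpha> \<beta> where \<alpha>\<beta>: "g = (\<alpha>, \<beta>)"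
      by (cases g)
    with g obtain a b c t where ac: "a \<noteq> 0" "c \<noteq> 0" and g': "\<alpha> = [:b, a:]" "\<beta> = [:t, c:]"
      and "[:b, a:] \<circ>\<^sub>p P = P \<circ>\<^sub>p [:t, c:]"
      unfolding \<alpha>\<beta> mem_isotropy_group_iff aff_carrier_iff by blast
    then have eq: "coeff ([:b:] + smult a P) i = coeff (P \<circ>\<^sub>p [:t, c:]) i" for i
      by (simp only: scale)
    obtain m where m: "d = Suc m" "m > 0"
      using d by (cases d) auto
    have "coeff (P \<circ>\<^sub>p [:t, c:]) m = 0"
      using eq[of m] sub m by (simp add: coeff_pCons split: nat.splits)
    then have "c ^ m * (of_nat (Suc m) * t * coeff P (Suc m)) = 0"
      using coeff_pcompose_affine_subtop[of P m t c] sub m d by simp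
    then have t: "t = 0"
      using ac lc m by (simp del: of_nat_Suc)
    have b: "b = 0"
      using eq[of 0] const t by (simp add: poly_0_coeff_0)
    have pow: "a * coeff P i = c ^ i * coeff P i" for i
      using eq[of i] by (simp add: t b coeff_pcompose_linear)
    have a: "a = c ^ d"
      using pow[of d] lc by simp
    have "c ^ (d - i) = 1" if i: "coeff P i \<noteq> 0" for i
    proof -
      have "c ^ (d - i) * c ^ i = c ^ i"
        using pow[of i] i a deg[OF i] by (simp flip: power_add)
      then show ?thesis
        using ac by simp
    qed
    then show "\<exists>c. c \<noteq> 0 \<and> g = ([:0, c ^ d:], [:0, c:]) \<and>
        (\<forall>i. coeff P i \<noteq> 0 \<longrightarrow> c ^ (d - i) = 1)"
      using ac a b t \<alpha>\<beta> g' by blast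
  next
    assume "\<exists>c. c \<noteq> 0 \<and> g = ([:0, c ^ d:], [:0, c:]) \<and>
      (\<forall>i. coeff P i \<noteq> 0 \<longrightarrow> c ^ (d - i) = 1)"
    then obtain c where c: "c \<noteq> 0" and g: "g = ([:0, c ^ d:], [:0, c:])"
      and one: "\<And>i. coeff P i \<noteq> 0 \<Longrightarrow> c ^ (d - i) = 1"
      by blast
    have "c ^ d * coeff P i = c ^ i * coeff P i" for i
    proof (cases "coeff P i = 0")
      case False
      have "c ^ d = c ^ (d - i) * c ^ i"
        using deg[OF False] by (simp flip: power_add)
      with one[OF False] show ?thesis by simp
    qed simp
    then have "[:0, c ^ d:] \<circ>\<^sub>p P = P \<circ>\<^sub>p [:0, c:]"
      by (simp add: scale poly_eq_iff coeff_pcompose_linear)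
    then show "g \<in> carrier (isotropy_group P)"
      using c by (auto simp: g mem_isotropy_group_iff aff_carrier_iff)
  qed
qed

lemma isotropy_group_X_power:
  assumes d: "d \<ge> 2"
  shows "isotropy_group (monom 1 d :: 'a::field_char_0 poly) \<cong> (mult_group :: 'a monoid)"
proof (rule isotropy_group_isoI[OF group_mult_group])
  let ?f = "\<lambda>c :: 'a. ([:0, c ^ d:], [:0, c:])"
  have "g \<in> carrier (isotropy_group (monom 1 d)) \<longleftrightarrow> (\<exists>c. c \<noteq> 0 \<and> g = ?f c)" for g
    using d by (subst mem_isotropy_group_reduced_iff[of _ d]) (auto simp: degree_monom_eq)
  then show "bij_betw ?f (carrier mult_group) (carrier (isotropy_group (monom 1 d)))"
    by (auto simp: bij_betw_def inj_on_def mult_group_def)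
qed (simp add: mult_group_def aff_pcompose power_mult_distrib del: pcompose_pCons)

section \<open>Roots of unity\<close>

lemma radically_closed_root:
  fixes a :: "'a::field"
  assumes "radically_closed TYPE('a)" and "n > 0"
  obtains x where "x ^ n = a"
proof (cases "n \<ge> 2")
  case True
  then have "splits (monom 1 n - [:a:])"
    using assms(1) by (simp add: radically_closed_def)
  then obtain c rs where "c \<noteq> 0" and eq: "monom 1 n - [:a:] = smult c (\<Prod>r\<leftarrow>rs. [:- r, 1:])"
    unfolding splits_def by blast
  have "coeff (monom 1 n - [:a:]) n = 1"
    using True by (simp add: coeff_pCons split: nat.splits)
  then have "rs \<noteq> []"
    using eq True by (auto simp: coeff_pCons split: nat.splits)
  then obtain x xs where "rs = x # xs"
    by (cases rs) auto
  then have "poly (monom 1 n - [:a:]) x = 0"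
    by (simp add: eq)
  then have "x ^ n = a"
    by (simp add: poly_monom)
  then show thesis ..
next
  case False
  with \<open>n > 0\<close> have "n = 1" by simp
  then show thesis
    using that[of a] by simp
qed

text \<open>If 1 were the only root of the split polynomial \<open>X^n - 1\<close>, it would have multiplicity
  \<open>n \<ge> 2\<close>; but the derivative takes the value \<open>n \<noteq> 0\<close> at 1.\<close>

lemma radically_closed_nontrivial_root_of_unity:
  assumes "radically_closed TYPE('a::field_char_0)" and n: "n \<ge> 2"
  obtains x :: "'a::field_char_0" where "x ^ n = 1" "x \<noteq> 1"
proof (rule ccontr)
  let ?p = "monom 1 n - [:1:] :: 'a poly"
  assume "\<not> thesis"
  then have only: "x = 1" if "x ^ n = 1" for x :: 'a
    using that \<open>\<And>x. x ^ n = 1 \<Longrightarrow> x \<noteq> 1 \<Longrightarrow> thesis\<close> by blast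
  have "splits ?p"
    using assms by (simp add: radically_closed_def)
  then obtain c rs where "c \<noteq> 0" and eq: "?p = smult c (\<Prod>r\<leftarrow>rs. [:- r, 1:])"
    unfolding splits_def by blast
  have "poly ?p r = 0" if "r \<in> set rs" for r
  proof -
    have "poly (\<Prod>r\<leftarrow>rs. [:- r, 1:]) r = 0"
      using that by (induction rs) auto
    then show ?thesis by (simp add: eq)
  qed
  then have "rs = replicate (length rs) 1"
    using only by (intro replicate_eqI) (auto simp: poly_monom)
  then have "?p = smult c ([:- 1, 1:] ^ length rs)"
    using eq by (metis map_replicate prod_list_replicate)
  moreover from this have "length rs = n"
  proof -
    have "degree ?p = n"
      using n by (intro antisym degree_le le_degree) (auto simp: coeff_pCons split: nat.splits)
    then show ?thesis
      using \<open>?p = smult c ([:- 1, 1:] ^ length rs)\<close> \<open>c \<noteq> 0\<close> by (simp add: degree_power_eq)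
  qed
  ultimately have "poly (pderiv ?p) 1 = poly (pderiv (smult c ([:- 1, 1:] ^ n))) 1"
    by simp
  then show False
    using n by (simp add: pderiv_diff pderiv_monom poly_monom pderiv_smult pderiv_power pderiv_pCons
        power_0_left)
qed

text \<open>Induction on the prime factors, from a primitive \<open>m\<close>-th root \<open>z\<close> to a primitive \<open>pm\<close>-th root.
  If \<open>p\<close> divides \<open>m\<close>, any \<open>p\<close>-th root of \<open>z\<close> works. Otherwise a \<open>p\<close>-th root of \<open>z\<close> may again
  have order \<open>m\<close>, so \<open>z\<close> is multiplied by a nontrivial \<open>p\<close>-th root of unity instead, and orders
  multiply because \<open>p\<close> and \<open>m\<close> are coprime.\<close>

lemma radically_closed_primitive_root_of_unity:
  assumes rc: "radically_closed TYPE('a::field_char_0)" and "n > 0"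
  obtains z :: "'a::field_char_0" where "\<And>k. z ^ k = 1 \<longleftrightarrow> n dvd k"
proof -
  have "\<exists>z :: 'a. \<forall>k. z ^ k = 1 \<longleftrightarrow> n dvd k"
    using \<open>n > 0\<close>
  proof (induction n rule: prime_divisors_induct)
    case (factor p m)
    then have p: "prime p" and "m > 0" "p \<ge> 2"
      using prime_ge_2_nat by auto
    with factor obtain z :: 'a where z: "\<And>k. z ^ k = 1 \<longleftrightarrow> m dvd k"
      by auto
    show ?case
    proof (cases "p dvd m")
      case True
      obtain y where y: "y ^ p = z"
        using radically_closed_root[OF rc, of p z] \<open>p \<ge> 2\<close> by auto
      have "y ^ k = 1 \<longleftrightarrow> p * m dvd k" for k
      proof
        assume k: "y ^ k = 1"
        have "z ^ k = (y ^ k) ^ p"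
          by (simp add: y[symmetric] mult.commute flip: power_mult)
        with k have "m dvd k"
          using z by simp
        with True obtain j where j: "k = p * j"
          by (meson dvd_trans dvdE)
        with k y z have "m dvd j"
          by (simp add: power_mult)
        with j show "p * m dvd k" by simp
      next
        assume "p * m dvd k"
        then show "y ^ k = 1"
          using y z[of m] by (auto simp: power_mult elim!: dvdE)
      qed
      then show ?thesis by blast
    next
      case False
      obtain y :: 'a where y: "y ^ p = 1" "y \<noteq> 1"
        using radically_closed_nontrivial_root_of_unity[OF rc \<open>p \<ge> 2\<close>] by blast
      have cop: "coprime p m"
        using p False prime_imp_coprime by blast
      have yk: "p dvd k" if k: "y ^ k = 1" for k
      proof (rule ccontr)
        assume "\<not> p dvd k"
        then have "coprime p k"
          using p prime_imp_coprime by blast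
        then obtain u v where "u * k = v * p + 1"
          using coprime_bezout_strong[of k p] p by (metis coprime_commute mult.commute not_prime_1)
        then have "(y ^ k) ^ u = (y ^ p) ^ v * y"
          by (metis mult.commute power_add power_mult power_one_right)
        with k y show False by simp
      qed
      have "(y * z) ^ k = 1 \<longleftrightarrow> p * m dvd k" for k
      proof
        assume k: "(y * z) ^ k = 1"
        have "z ^ (p * k) = (y ^ p) ^ k * z ^ (p * k)"
          using y by simp
        also have "\<dots> = ((y * z) ^ k) ^ p"
          by (simp add: power_mult_distrib mult.commute flip: power_mult)
        finally have "m dvd p * k"
          using k z by simp
        then have m: "m dvd k"
          using cop by (simp add: coprime_dvd_mult_right_iff coprime_commute)
        then have "y ^ k = 1"
          using k z[of k] by (simp add: power_mult_distrib)
        then have "p dvd k"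
          by (rule yk)
        with m show "p * m dvd k"
          using cop by (simp add: divides_mult)
      next
        assume *: "p * m dvd k"
        then have "z ^ k = 1"
          using z dvd_mult_right by blast
        moreover have "y ^ k = 1"
          using * y by (auto simp: power_mult elim!: dvdE)
        ultimately show "(y * z) ^ k = 1"
          by (simp add: power_mult_distrib)
      qed
      then show ?thesis by blast
    qed
  next
    case (unit n)
    then show ?case by (auto intro: exI[of _ 1])
  qed auto
  then show thesis
    using that by blast
qed

text \<open>The first \<open>n\<close> powers of \<open>z\<close> are distinct \<open>n\<close>-th roots of unity, and \<open>X^n - 1\<close> has no room for
  further roots.\<close>

lemma primitive_root_of_unity_powers:
  fixes z :: "'a::field"
  assumes z: "\<And>k. z ^ k = 1 \<longleftrightarrow> n dvd k" and n: "n > 0"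
  shows "bij_betw (\<lambda>k. z ^ k) {..<n} {c. c ^ n = 1}"
proof -
  have "z \<noteq> 0"
    using z[of n] n by (auto simp: power_0_left)
  have inj: "inj_on (\<lambda>k. z ^ k) {..<n}"
  proof (rule linorder_inj_onI)
    fix i j assume ij: "i < j" "i \<in> {..<n}" "j \<in> {..<n}"
    have "z ^ j = z ^ (j - i) * z ^ i"
      using ij by (simp flip: power_add)
    moreover have "z ^ (j - i) \<noteq> 1"
      using ij z nat_dvd_not_less[of "j - i" n] by auto
    ultimately show "z ^ i \<noteq> z ^ j"
      using \<open>z \<noteq> 0\<close> by auto
  qed auto
  have p: "monom 1 n - [:1:] \<noteq> (0 :: 'a poly)" "degree (monom 1 n - [:1 :: 'a:]) \<le> n"
  proof -
    have "coeff (monom 1 n - [:1 :: 'a:]) n = 1"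
      using n by (simp add: coeff_pCons split: nat.splits)
    then show "monom 1 n - [:1:] \<noteq> (0 :: 'a poly)"
      by (metis coeff_0 zero_neq_one)
    show "degree (monom 1 n - [:1 :: 'a:]) \<le> n"
      by (intro degree_diff_le degree_monom_le) simp
  qed
  have roots: "{c. c ^ n = 1} = {c :: 'a. poly (monom 1 n - [:1:]) c = 0}"
    by (simp add: poly_monom)
  have fin: "finite {c :: 'a. c ^ n = 1}"
    unfolding roots by (rule poly_roots_finite[OF p(1)])
  have "card {c :: 'a. c ^ n = 1} \<le> n"
    unfolding roots using card_poly_roots_bound[OF p(1)] p(2) by (rule order_trans)
  moreover have "card ((\<lambda>k. z ^ k) ` {..<n}) = n"
    using inj by (simp add: card_image)
  moreover have "(\<lambda>k. z ^ k) ` {..<n} \<subseteq> {c. c ^ n = 1}"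
    using z by (auto simp flip: power_mult)
  ultimately have "(\<lambda>k. z ^ k) ` {..<n} = {c. c ^ n = 1}"
    using fin by (intro card_seteq) auto
  with inj show ?thesis
    by (simp add: bij_betw_def)
qed

text \<open>The exponents that kill \<open>c\<close> are closed under multiples and, by Bezout, under greatest common
  divisors.\<close>

lemma power_Gcd_eq_1_iff:
  fixes c :: "'a::field"
  assumes A: "finite A"
  shows "c ^ Gcd A = 1 \<longleftrightarrow> (\<forall>k\<in>A. c ^ k = 1)"
proof
  assume *: "c ^ Gcd A = 1"
  show "\<forall>k\<in>A. c ^ k = 1"
  proof
    fix k assume "k \<in> A"
    then have "Gcd A dvd k" by simp
    then show "c ^ k = 1"
      using * by (auto simp: power_mult elim!: dvdE)
  qed
next
  have gcd: "c ^ gcd k l = 1" if "c ^ k = 1" "c ^ l = 1" for k l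
  proof (cases "k = 0")
    case False
    then obtain x y where "k * x = l * y + gcd k l"
      using bezout_nat by blast
    then have "(c ^ k) ^ x = (c ^ l) ^ y * c ^ gcd k l"
      by (simp flip: power_mult power_add)
    with that show ?thesis by simp
  qed (use that in simp)
  assume "\<forall>k\<in>A. c ^ k = 1"
  with A show "c ^ Gcd A = 1"
    by (induction A rule: finite_induct) (auto simp: gcd)
qed

section \<open>Delta-polynomials that are not monomials\<close>

lemma coeff_delta_form:
  assumes "e < d"
  shows "coeff (delta_form d e a) i =
    (if i = d then 1 else if i = e then of_nat d else if 1 \<le> i \<and> i < e then a i else 0)"
  using assms by (auto simp: delta_form_def coeff_sum)

lemma isotropy_group_delta_form:
  fixes a :: "nat \<Rightarrow> 'a::field_char_0"
  assumes rc: "radically_closed TYPE('a)" and e: "1 \<le> e" "e + 2 \<le> d"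
  shows "isotropy_group (delta_form d e a) \<cong>
    integer_mod_group (Gcd (insert (d - e) {d - i | i. i < e \<and> coeff (delta_form d e a) i \<noteq> 0}))"
    (is "isotropy_group ?P \<cong> integer_mod_group (Gcd ?A)")
proof -
  have A: "finite ?A" by simp
  define n where "n = Gcd ?A"
  have n: "n > 0"
    using e by (auto simp: n_def intro: Nat.gr0I)
  obtain z :: 'a where z: "\<And>k. z ^ k = 1 \<longleftrightarrow> n dvd k"
    using radically_closed_primitive_root_of_unity[OF rc n] by blast
  have coeff: "coeff ?P i =
      (if i = d then 1 else if i = e then of_nat d else if 1 \<le> i \<and> i < e then a i else 0)" for i
    using e by (simp add: coeff_delta_form)
  have deg: "degree ?P = d"
    using e by (intro antisym degree_le le_degree) (auto simp: coeff)
  let ?f = "\<lambda>c :: 'a. ([:0, c ^ d:], [:0, c:])"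
  \<comment> \<open>The leading exponent contributes \<open>c^0 = 1\<close>, and \<open>e\<close> itself occurs because \<open>d \<noteq> 0\<close> in \<open>K\<close>.\<close>
  have supp: "(\<forall>i. coeff ?P i \<noteq> 0 \<longrightarrow> c ^ (d - i) = 1) \<longleftrightarrow> (\<forall>k\<in>?A. c ^ k = 1)" for c :: 'a
  proof -
    have "coeff ?P i \<noteq> 0 \<longleftrightarrow> i = d \<or> i = e \<or> i < e \<and> coeff ?P i \<noteq> 0" for i
      using e by (auto simp: coeff)
    then have "(\<forall>i. coeff ?P i \<noteq> 0 \<longrightarrow> c ^ (d - i) = 1) \<longleftrightarrow>
        (\<forall>i. i = d \<or> i = e \<or> i < e \<and> coeff ?P i \<noteq> 0 \<longrightarrow> c ^ (d - i) = 1)"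
      by simp
    also have "\<dots> \<longleftrightarrow> (\<forall>k\<in>?A. c ^ k = 1)"
      by auto
    finally show ?thesis .
  qed
  have mem: "g \<in> carrier (isotropy_group ?P) \<longleftrightarrow> g \<in> ?f ` {c. c ^ n = 1}" for g
  proof -
    have "g \<in> carrier (isotropy_group ?P) \<longleftrightarrow>
        (\<exists>c. c \<noteq> 0 \<and> g = ?f c \<and> (\<forall>i. coeff ?P i \<noteq> 0 \<longrightarrow> c ^ (d - i) = 1))"
      using e by (intro mem_isotropy_group_reduced_iff deg) (auto simp: coeff)
    also have "\<dots> \<longleftrightarrow> (\<exists>c. c \<noteq> 0 \<and> g = ?f c \<and> c ^ n = 1)"
      unfolding supp n_def using power_Gcd_eq_1_iff[OF A] by blast
    also have "\<dots> \<longleftrightarrow> g \<in> ?f ` {c. c ^ n = 1}"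
      using n by (auto simp: power_0_left)
    finally show ?thesis .
  qed
  have "isotropy_group ?P \<cong> integer_mod_group n"
  proof (rule isotropy_group_isoI)
    have "bij_betw nat {0..<int n} {..<n}"
      by (rule bij_betw_byWitness[of _ int]) auto
    then have "bij_betw ((\<lambda>k. z ^ k) \<circ> nat) (carrier (integer_mod_group n)) {c. c ^ n = 1}"
      using primitive_root_of_unity_powers[OF z n] n
      by (simp add: carrier_integer_mod_group bij_betw_trans)
    moreover have "bij_betw ?f {c. c ^ n = 1} (carrier (isotropy_group ?P))"
      using mem by (auto simp: bij_betw_def inj_on_def)
    ultimately show "bij_betw (?f \<circ> ((\<lambda>k. z ^ k) \<circ> nat)) (carrier (integer_mod_group n))
        (carrier (isotropy_group ?P))"
      by (rule bij_betw_trans)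
    fix x y assume "x \<in> carrier (integer_mod_group n)" "y \<in> carrier (integer_mod_group n)"
    then have xy: "x \<ge> 0" "y \<ge> 0"
      using n by (auto simp: carrier_integer_mod_group)
    have zn: "z ^ n = 1"
      using z by simp
    have "z ^ nat ((x + y) mod int n) = z ^ ((nat x + nat y) mod n)"
      using xy by (simp add: nat_mod_distrib nat_add_distrib)
    also have "\<dots> = (z ^ n) ^ ((nat x + nat y) div n) * z ^ ((nat x + nat y) mod n)"
      by (simp add: zn)
    also have "\<dots> = z ^ nat x * z ^ nat y"
      by (simp flip: power_mult power_add)
    finally show "(?f \<circ> ((\<lambda>k. z ^ k) \<circ> nat)) (x \<otimes>\<^bsub>integer_mod_group n\<^esub> y) =
        (fst ((?f \<circ> ((\<lambda>k. z ^ k) \<circ> nat)) x) \<circ>\<^sub>p fst ((?f \<circ> ((\<lambda>k. z ^ k) \<circ> nat)) y),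
         snd ((?f \<circ> ((\<lambda>k. z ^ k) \<circ> nat)) x) \<circ>\<^sub>p snd ((?f \<circ> ((\<lambda>k. z ^ k) \<circ> nat)) y))"
      by (simp add: aff_pcompose power_mult_distrib del: pcompose_pCons)
  qed simp
  then show ?thesis
    by (simp add: n_def)
qed

section \<open>Delta-polynomials in every orbit\<close>

text \<open>Constants are moved to 1 by a translation and affine polynomials to \<open>X\<close> by their inverse.
  In degree \<open>d \<ge> 2\<close> the translation by \<open>t\<close> gives \<open>R\<close> without \<open>X^(d-1)\<close>; after that a single factor
  \<open>u\<close> is left to choose, and the rest of the normalization is forced.\<close>

lemma orbit_contains_delta_polynomial:
  fixes Q :: "'a::field_char_0 poly"
  assumes rc: "radically_closed TYPE('a)"
  obtains \<alpha> \<beta> where "\<alpha> \<in> carrier aff_group" "\<beta> \<in> carrier aff_group"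
    "delta_polynomial (\<alpha> \<circ>\<^sub>p Q \<circ>\<^sub>p \<beta>)"
proof -
  consider (const) "degree Q = 0" | (linear) "degree Q = 1" | (high) "degree Q \<ge> 2"
    by linarith
  then show thesis
  proof cases
    case const
    then obtain q where "Q = [:q:]"
      by (rule degree_eq_zeroE)
    then have "[:1 - q, 1:] \<circ>\<^sub>p Q \<circ>\<^sub>p [:0, 1:] = monom 1 0"
      by (simp add: pcompose_pCons one_pCons)
    then have "delta_polynomial ([:1 - q, 1:] \<circ>\<^sub>p Q \<circ>\<^sub>p [:0, 1:])"
      unfolding delta_polynomial_def by blast
    then show thesis
      by (intro that[of "[:1 - q, 1:]" "[:0, 1:]"]) (auto simp: aff_carrier_iff)
  next
    case linear
    have "Q \<in> carrier aff_group"
      using degree1_coeffs[OF linear] by (metis aff_carrier_iff)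
    moreover from this have "[:0, 1:] \<circ>\<^sub>p Q \<circ>\<^sub>p inv\<^bsub>aff_group\<^esub> Q = monom 1 1"
      by (simp add: aff_inv_pcompose pcompose_pCons monom_altdef)
    then have "delta_polynomial ([:0, 1:] \<circ>\<^sub>p Q \<circ>\<^sub>p inv\<^bsub>aff_group\<^esub> Q)"
      unfolding delta_polynomial_def by metis
    ultimately show thesis
      by (intro that[of "[:0, 1:]" "inv\<^bsub>aff_group\<^esub> Q"] group.inv_closed group_aff_group)
        (auto simp: aff_carrier_iff)
  next
    case high
    then obtain m where m: "degree Q = Suc m" "m \<ge> 1"
      by (cases "degree Q") auto
    define d where "d = Suc m"
    have lc: "coeff Q d \<noteq> 0"
      using m by (metis d_def degree_0 leading_coeff_0_iff nat.distinct(1))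
    define t where "t = - coeff Q m / (of_nat d * coeff Q d)"
    define R where "R = Q \<circ>\<^sub>p [:t, 1:]"
    have R_m: "coeff R m = 0"
      unfolding R_def using lc m
      by (subst coeff_pcompose_affine_subtop) (auto simp: t_def d_def simp del: of_nat_Suc)
    have deg_R: "degree R = d"
      by (simp add: R_def m d_def degree_pcompose)
    then have lc_R: "coeff R d \<noteq> 0"
      by (metis Zero_not_Suc d_def degree_0 leading_coeff_0_iff)
    \<comment> \<open>With \<open>X\<close> rescaled by \<open>u\<close>, the left factor subtracts the constant term of \<open>R\<close> and
      divides by the leading coefficient \<open>u^d R_d\<close>.\<close>
    have normal: "coeff ([:- coeff R 0 / (u ^ d * coeff R d), 1 / (u ^ d * coeff R d):] \<circ>\<^sub>p Q \<circ>\<^sub>p [:t, u:]) i =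
        (if i = 0 then 0 else u ^ i * coeff R i / (u ^ d * coeff R d))" for u i
    proof -
      have "[:t, u:] = [:t, 1:] \<circ>\<^sub>p [:0, u:]"
        by (simp add: pcompose_pCons)
      then have "[:- coeff R 0 / (u ^ d * coeff R d), 1 / (u ^ d * coeff R d):] \<circ>\<^sub>p Q \<circ>\<^sub>p [:t, u:] =
          [:- coeff R 0 / (u ^ d * coeff R d), 1 / (u ^ d * coeff R d):] \<circ>\<^sub>p (R \<circ>\<^sub>p [:0, u:])"
        by (simp only: R_def pcompose_assoc)
      then show ?thesis
        by (simp add: pcompose_pCons[of _ "[:_:]"] coeff_pcompose_linear coeff_pCons split: nat.splits)
    qed
    \<comment> \<open>Only the coefficients of the normalized polynomial matter from here on.\<close>
    note witness = that
    have scaled: thesis if u: "u \<noteq> 0" and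
      delta: "\<And>P. (\<And>i. coeff P i = (if i = 0 then 0 else u ^ i * coeff R i / (u ^ d * coeff R d))) \<Longrightarrow>
        delta_polynomial P" for u
      using u lc_R
      by (intro witness[OF _ _ delta[OF normal]]) (auto simp: aff_carrier_iff)
    show thesis
    proof (cases "\<exists>i. 0 < i \<and> i < d \<and> coeff R i \<noteq> 0")
      case False
      show thesis
      proof (rule scaled[of 1])
        fix P assume P: "\<And>i. coeff P i = (if i = 0 then 0 else 1 ^ i * coeff R i / (1 ^ d * coeff R d))"
        have "coeff R i = 0" if "i > d" for i
          using that deg_R by (simp add: coeff_eq_0)
        then have "coeff P i = coeff (monom 1 d) i" for i
          using False lc_R by (cases i d rule: linorder_cases) (auto simp: P d_def)
        then have "P = monom 1 d"
          by (rule poly_eqI)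
        then show "delta_polynomial P"
          unfolding delta_polynomial_def by blast
      qed simp
    next
      case True
      \<comment> \<open>\<open>e\<close> is the second highest exponent; it differs from \<open>d - 1\<close> because \<open>R\<close> has no such term.\<close>
      define S where "S = {i. 0 < i \<and> i < d \<and> coeff R i \<noteq> 0}"
      define e where "e = Max S"
      have S: "finite S" "S \<noteq> {}"
        using True by (auto simp: S_def)
      have "e \<in> S"
        unfolding e_def using S by (rule Max_in)
      then have e: "0 < e" "e < d" "coeff R e \<noteq> 0"
        by (auto simp: S_def)
      have "e \<noteq> m"
        using e R_m by auto
      with e have e2: "e + 2 \<le> d"
        by (simp add: d_def)
      have gap: "coeff R i = 0" if "e < i" "i < d" for i
      proof (rule ccontr)
        assume "coeff R i \<noteq> 0"
        with that have "i \<in> S"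
          by (simp add: S_def)
        then have "i \<le> e"
          unfolding e_def using S by simp
        with that show False by simp
      qed
      have above: "coeff R i = 0" if "i > d" for i
        using that deg_R by (simp add: coeff_eq_0)
      \<comment> \<open>The normalized coefficient at \<open>e\<close> is \<open>R_e / (u^(d-e) R_d)\<close>, which has to become \<open>d\<close>.\<close>
      obtain u where u: "u ^ (d - e) = coeff R e / (of_nat d * coeff R d)"
        using radically_closed_root[OF rc, of "d - e"] e by auto
      have d0: "(of_nat d :: 'a) \<noteq> 0"
        by (simp add: d_def del: of_nat_Suc)
      have u0: "u \<noteq> 0"
        using u e d0 lc_R by (auto simp: power_0_left)
      have "u ^ d * coeff R d = u ^ e * (u ^ (d - e) * coeff R d)"
        using e by (simp flip: power_add mult.assoc)
      also have "u ^ (d - e) * coeff R d = coeff R e / of_nat d"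
        using u lc_R by simp
      finally have ue: "u ^ e * coeff R e / (u ^ d * coeff R d) = of_nat d"
        using u0 e d0 by simp
      show thesis
      proof (rule scaled[OF u0])
        fix P assume P: "\<And>i. coeff P i = (if i = 0 then 0 else u ^ i * coeff R i / (u ^ d * coeff R d))"
        have "coeff P i = coeff (delta_form d e (coeff P)) i" for i
        proof -
          consider "i = 0" | "0 < i" "i < e" | "i = e" | "e < i" "i < d" | "i = d" | "i > d"
            by linarith
          then show ?thesis
            using e u0 lc_R ue gap above by cases (auto simp: coeff_delta_form P)
        qed
        then have "P = delta_form d e (coeff P)"
          by (rule poly_eqI)
        then show "delta_polynomial P"
          using e e2 unfolding delta_polynomial_def by (metis One_nat_def Suc_leI)
      qed
    qed
  qed
qed

theorem proposition2p7:
  assumes "radically_closed TYPE('a::field_char_0)"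
  shows
    "isotropy_group (1 :: 'a poly) \<cong> (mult_group :: 'a monoid) \<times>\<times> (aff_group :: 'a poly monoid)
     \<and> isotropy_group (monom 1 1 :: 'a poly) \<cong> (aff_group :: 'a poly monoid)
     \<and> (\<forall>d\<ge>2. isotropy_group (monom 1 d :: 'a poly) \<cong> (mult_group :: 'a monoid))
     \<and> (\<forall>d e (a :: nat \<Rightarrow> 'a). 1 \<le> e \<longrightarrow> e + 2 \<le> d \<longrightarrow>
          isotropy_group (delta_form d e a) \<cong>
            integer_mod_group (Gcd (insert (d - e) {d - i | i. i < e \<and> coeff (delta_form d e a) i \<noteq> 0})))
     \<and> (\<forall>Q :: 'a poly. \<exists>P :: 'a poly. delta_polynomial P \<and> isotropy_group Q \<cong> isotropy_group P)"
proof (intro conjI allI impI)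
  show "isotropy_group (1 :: 'a poly) \<cong> (mult_group :: 'a monoid) \<times>\<times> (aff_group :: 'a poly monoid)"
    by (rule isotropy_group_one)
  show "isotropy_group (monom 1 1 :: 'a poly) \<cong> (aff_group :: 'a poly monoid)"
    using isotropy_group_X[where 'a = 'a] by (simp add: monom_altdef)
  show "isotropy_group (monom 1 d :: 'a poly) \<cong> (mult_group :: 'a monoid)" if "2 \<le> d" for d
    using that by (rule isotropy_group_X_power)
  show "isotropy_group (delta_form d e a) \<cong>
      integer_mod_group (Gcd (insert (d - e) {d - i | i. i < e \<and> coeff (delta_form d e a) i \<noteq> 0}))"
    if "1 \<le> e" "e + 2 \<le> d" for d e and a :: "nat \<Rightarrow> 'a"
    using assms that by (rule isotropy_group_delta_form)
  show "\<exists>P :: 'a poly. delta_polynomial P \<and> isotropy_group Q \<cong> isotropy_group P" for Q :: "'a poly"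
  proof -
    obtain \<alpha> \<beta> where "\<alpha> \<in> carrier aff_group" "\<beta> \<in> carrier aff_group"
      "delta_polynomial (\<alpha> \<circ>\<^sub>p Q \<circ>\<^sub>p \<beta>)"
      using orbit_contains_delta_polynomial[OF assms] by blast
    then show ?thesis
      using isotropy_group_iso_along_orbit by blast
  qed
qed

end
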